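(* Let $X$ and $Y$ be Banach spaces (over the same scalar field, $\mathbb{R}$ or $\mathbb{C}$), and let $\Gamma \subseteq X \times Y$ be a closed linear relation, i.e. a linear subspace of the Banach space $X \times Y$ that is closed, with $\mathrm{Dom}\,\Gamma = X$. If $B \subseteq Y$ is open, then $\Gamma B \subseteq X$ is open.
   Context: A linear relation from $X$ to $Y$ is a linear subspace $\Gamma$ of the Banach space $X \times Y$ (with the product topology). For $B \subseteq Y$, define $\Gamma B = \{ x \in X : \exists\, b \in B,\ (x,b) \in \Gamma \} \subseteq X$. The domain of $\Gamma$ is $\mathrm{Dom}\,\Gamma = \Gamma Y = \{ x \in X : \exists\, y \in Y,\ (x,y) \in \Gamma \}$. *)

theory Defs
  imports "HOL-Analysis.Analysis"
begin

text \<open>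
  The class \<^class>\<open>banach\<close> only provides real scalars. Complex scalars are covered by an explicit
  scalar multiplication over a field \<open>'k\<close> of class \<^class>\<open>real_normed_field\<close>; norms in this class are
  multiplicative, so by the Gelfand--Mazur theorem its instances are, up to isometric isomorphism,
  exactly the real and the complex numbers. The second clause makes the real scaling of the type
  the restriction of \<open>s\<close>, so for \<open>'k = real\<close> it forces \<open>s = scaleR\<close>.
\<close>

definition banach_space_over :: "('k::real_normed_field \<Rightarrow> 'a::banach \<Rightarrow> 'a) \<Rightarrow> bool" where
  "banach_space_over s \<longleftrightarrow>
     vector_space s \<and>
     (\<forall>r x. s (of_real r) x = r *\<^sub>R x) \<and>
     (\<forall>c x. norm (s c x) = norm c * norm x)"

definition linear_relation ::
  "('k::real_normed_field \<Rightarrow> 'a::banach \<Rightarrow> 'a) \<Rightarrow> ('k \<Rightarrow> 'b::banach \<Rightarrow> 'b) \<Rightarrow> ('a \<times> 'b) set \<Rightarrow> bool" where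
  "linear_relation sX sY \<Gamma> \<longleftrightarrow> module.subspace (module_prod.scale sX sY) \<Gamma>"

definition rel_preimage :: "('a \<times> 'b) set \<Rightarrow> 'b set \<Rightarrow> 'a set" where
  "rel_preimage \<Gamma> B = {x. \<exists>b\<in>B. (x, b) \<in> \<Gamma>}"

definition rel_dom :: "('a \<times> 'b) set \<Rightarrow> 'a set" where
  "rel_dom \<Gamma> = rel_preimage \<Gamma> UNIV"

lemma banach_space_over_scaleR: "banach_space_over (scaleR :: real \<Rightarrow> 'a::banach \<Rightarrow> 'a)"
  unfolding banach_space_over_def by (simp add: real_vector.vector_space_axioms)

lemma banach_space_over_complex: "banach_space_over ((*) :: complex \<Rightarrow> complex \<Rightarrow> complex)"
  unfolding banach_space_over_def
  by (auto simp: vector_space_def algebra_simps norm_mult scaleR_conv_of_real)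

lemma linear_relation_scaleR_iff:
  "linear_relation (*\<^sub>R) (*\<^sub>R) \<Gamma> \<longleftrightarrow> subspace \<Gamma>"
  unfolding linear_relation_def module_prod_scale_eq_scaleR subspace_raw_def ..

lemma rel_dom_eq_Domain: "rel_dom \<Gamma> = Domain \<Gamma>"
  by (auto simp: rel_dom_def rel_preimage_def)

end

(* The argument of the open mapping theorem, run directly on the relation. By the Baire category
   theorem in X, some closure of \<Gamma>(ball 0 n) has interior, so every x is the first component of an
   element of \<Gamma> up to an error \<open>norm x / 2\<close>, with second component bounded by \<open>M * norm x\<close>.
   Iterating on the error and summing the second components in Y (here closedness of \<Gamma> is used)
   gives an exact \<open>(x, y) \<in> \<Gamma>\<close> with \<open>norm y \<le> 2 * M * norm x\<close>; openness follows by translation. *)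
theory Submission
  imports Defs
begin

text \<open>Reduces the theorem to real scalars: open and closed sets do not depend on the scalar
  field, and real scaling is the action of the scalars \<open>of_real r\<close>.\<close>

lemma linear_relation_imp_subspace:
  assumes "banach_space_over sX" "banach_space_over sY" "linear_relation sX sY \<Gamma>"
  shows "subspace \<Gamma>"
proof -
  interpret X: vector_space sX using assms(1) by (simp add: banach_space_over_def)
  interpret Y: vector_space sY using assms(2) by (simp add: banach_space_over_def)
  interpret P: vector_space_prod sX sY ..
  have sub: "P.p.subspace \<Gamma>"
    using assms(3) by (simp add: linear_relation_def)
  have "r *\<^sub>R p \<in> \<Gamma>" if "p \<in> \<Gamma>" for r p
  proof -
    have "P.scale (of_real r) p = r *\<^sub>R p"
      using assms(1,2) by (simp add: P.scale_def banach_space_over_def scaleR_prod_def)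
    then show ?thesis
      using P.p.subspace_scale[OF sub that, of "of_real r"] by simp
  qed
  then show ?thesis
    using P.p.subspace_0[OF sub] P.p.subspace_add[OF sub] by (simp add: subspace_def)
qed

lemma Baire_nat_closed:
  fixes F :: "nat \<Rightarrow> 'a::{real_normed_vector, complete_space} set"
  assumes "\<And>n. closed (F n)" and "(\<Union>n. F n) = UNIV"
  obtains n where "interior (F n) \<noteq> {}"
proof -
  have "Met_TC.mcomplete TYPE('a)"
    by (simp add: complete_UNIV)
  then have "interior (\<Union>n. F n) = {}" if "\<And>n. interior (F n) = {}"
    using Met_TC.metric_Baire_category_alt[where 'a = 'a, of "range F"] assms(1) that by auto
  then show thesis
    using that assms(2) by auto
qed

lemma subspace_approximate_section:
  fixes \<Gamma> :: "('x::banach \<times> 'y::real_normed_vector) set"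
  assumes sub: "subspace \<Gamma>" and dom: "Domain \<Gamma> = UNIV"
  obtains M where "M > 0"
    and "\<And>x. \<exists>u v. (u, v) \<in> \<Gamma> \<and> norm (x - u) \<le> norm x / 2 \<and> norm v \<le> M * norm x"
proof -
  define F where "F n = closure {x. \<exists>y. (x, y) \<in> \<Gamma> \<and> norm y \<le> real n}" for n
  have "x \<in> (\<Union>n. F n)" for x
  proof -
    obtain y where y: "(x, y) \<in> \<Gamma>" using dom by blast
    obtain n where "norm y \<le> real n" using real_arch_simple by blast
    with y have "x \<in> F n"
      unfolding F_def by (intro subsetD[OF closure_subset]) auto
    then show ?thesis by blast
  qed
  then have union: "(\<Union>n. F n) = UNIV" by blast
  have "closed (F n)" for n by (simp add: F_def)
  then obtain n where "interior (F n) \<noteq> {}"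
    using Baire_nat_closed[OF _ union] by blast
  then obtain x0 e where e: "e > 0" and ball: "ball x0 e \<subseteq> F n"
    by (meson all_not_in_conv mem_interior)
  have approx: "\<exists>u v. (u, v) \<in> \<Gamma> \<and> norm v \<le> real n \<and> norm (z - u) < d"
    if "z \<in> ball x0 e" "d > 0" for z d
  proof -
    have "z \<in> closure {x. \<exists>y. (x, y) \<in> \<Gamma> \<and> norm y \<le> real n}"
      using ball that(1) by (auto simp: F_def)
    then obtain u where "u \<in> {x. \<exists>y. (x, y) \<in> \<Gamma> \<and> norm y \<le> real n}" "dist u z < d"
      using \<open>d > 0\<close> unfolding closure_approachable by blast
    then show ?thesis by (auto simp: dist_norm norm_minus_commute)
  qed
  \<comment> \<open>The second component built below has norm at most \<open>c * n\<close> with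
    \<open>c = 2 * norm x / e\<close>; replacing \<open>n\<close> by \<open>n + 1\<close> keeps
    \<open>M\<close> positive when \<open>n = 0\<close>.\<close>
  define M where "M = 2 * (real n + 1) / e"
  have "\<exists>u v. (u, v) \<in> \<Gamma> \<and> norm (x - u) \<le> norm x / 2 \<and> norm v \<le> M * norm x" for x
  proof (cases "x = 0")
    case True
    have "(0, 0) \<in> \<Gamma>" using subspace_0[OF sub] by (simp add: zero_prod_def)
    then show ?thesis using True by (intro exI[of _ 0]) simp
  next
    case False
    \<comment> \<open>Scaling \<open>x\<close> down to \<open>z\<close> of norm \<open>e / 2\<close>
      puts both \<open>x0 + z\<close> and \<open>x0 - z\<close> inside the ball around
      \<open>x0\<close>.\<close>
    define c where "c = 2 * norm x / e"
    define z where "z = (1 / c) *\<^sub>R x"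
    have c: "c > 0" using False e by (simp add: c_def)
    have x: "x = c *\<^sub>R z" using c by (simp add: z_def)
    have nx: "norm x = c * e / 2" using e by (simp add: c_def)
    have "norm z = e / 2" using x nx c by simp
    then have "x0 + z \<in> ball x0 e" "x0 - z \<in> ball x0 e"
      using e by (auto simp: dist_norm)
    then obtain u1 v1 u2 v2
      where 1: "(u1, v1) \<in> \<Gamma>" "norm v1 \<le> real n" "norm (x0 + z - u1) < e / 4"
        and 2: "(u2, v2) \<in> \<Gamma>" "norm v2 \<le> real n" "norm (x0 - z - u2) < e / 4"
      using approx[of "x0 + z" "e / 4"] approx[of "x0 - z" "e / 4"] e by auto
    \<comment> \<open>Half the difference of the two approximations eliminates the unknown centre
      \<open>x0\<close>, since \<open>z\<close> is half of \<open>(x0 + z) - (x0 - z)\<close>; the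
      factor \<open>c\<close> undoes the scaling.\<close>
    define u v where "u = (c / 2) *\<^sub>R (u1 - u2)" and "v = (c / 2) *\<^sub>R (v1 - v2)"
    have "(u, v) \<in> \<Gamma>"
      using subspace_scale[OF sub subspace_diff[OF sub 1(1) 2(1)], of "c / 2"]
      by (simp add: u_def v_def)
    moreover have "norm (x - u) \<le> norm x / 2"
    proof -
      have "x - u = (c / 2) *\<^sub>R ((x0 + z - u1) - (x0 - z - u2))"
        by (simp add: x u_def algebra_simps flip: scaleR_add_left)
      then have "norm (x - u) = c / 2 * norm ((x0 + z - u1) - (x0 - z - u2))"
        using c by simp
      \<comment> \<open>The tolerance \<open>e / 4\<close> was chosen for this: the bound equals
        \<open>c * e / 4\<close>, which is \<open>norm x / 2\<close>.\<close>
      also have "\<dots> \<le> c / 2 * (e / 4 + e / 4)"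
        using c 1(3) 2(3) by (intro mult_left_mono order_trans[OF norm_triangle_ineq4]) auto
      finally show ?thesis by (simp add: nx)
    qed
    moreover have "norm v \<le> M * norm x"
    proof -
      have "norm v = c / 2 * norm (v1 - v2)"
        using c by (simp add: v_def)
      also have "\<dots> \<le> c / 2 * (real n + real n)"
        using c 1(2) 2(2) by (intro mult_left_mono order_trans[OF norm_triangle_ineq4]) auto
      also have "\<dots> \<le> c * (real n + 1)"
        using c by (simp add: field_simps)
      also have "\<dots> = M * norm x"
        using e by (simp add: M_def nx)
      finally show ?thesis .
    qed
    ultimately show ?thesis by blast
  qed
  moreover have "M > 0" using e by (simp add: M_def)
  ultimately show thesis using that by blast
qed

lemma closed_subspace_bounded_section:
  fixes \<Gamma> :: "('x::banach \<times> 'y::banach) set"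
  assumes sub: "subspace \<Gamma>" and cl: "closed \<Gamma>" and dom: "Domain \<Gamma> = UNIV"
  obtains K where "K > 0" and "\<And>x. \<exists>y. (x, y) \<in> \<Gamma> \<and> norm y \<le> K * norm x"
proof -
  obtain M where M: "M > 0"
    and "\<forall>x. \<exists>u v. (u, v) \<in> \<Gamma> \<and> norm (x - u) \<le> norm x / 2 \<and> norm v \<le> M * norm x"
    using subspace_approximate_section[OF sub dom] by metis
  \<comment> \<open>Choosing \<open>u\<close> and \<open>v\<close> as functions lets the correction
    be iterated; neither has to be linear or continuous.\<close>
  then obtain u v where uv: "\<And>x. (u x, v x) \<in> \<Gamma>"
    and u: "\<And>x. norm (x - u x) \<le> norm x / 2" and v: "\<And>x. norm (v x) \<le> M * norm x"
    by metis
  have "\<exists>y. (x, y) \<in> \<Gamma> \<and> norm y \<le> (2 * M) * norm x" for x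
  proof -
    \<comment> \<open>\<open>r n\<close> is the error left after \<open>n\<close> corrections; each
      correction at least halves its norm.\<close>
    define r where "r n = ((\<lambda>x. x - u x) ^^ n) x" for n
    have r_Suc: "r (Suc n) = r n - u (r n)" and r_0: "r 0 = x" for n
      by (simp_all add: r_def)
    have nr: "norm (r n) \<le> norm x * (1 / 2) ^ n" for n
    proof (induction n)
      case (Suc n)
      then show ?case using u[of "r n"] by (simp add: r_Suc)
    qed (simp add: r_0)
    have r_lim: "r \<longlonglongrightarrow> 0"
    proof (rule Lim_null_comparison)
      show "(\<lambda>n. norm x * (1 / 2) ^ n) \<longlonglongrightarrow> 0"
        by (intro tendsto_mult_right_zero LIMSEQ_power_zero) simp
    qed (use nr in auto)
    have nv: "norm (v (r n)) \<le> (M * norm x) * (1 / 2) ^ n" for n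
      using order_trans[OF v mult_left_mono[OF nr]] M by (simp add: mult.assoc)
    \<comment> \<open>The sum 2 of the geometric series is the source of the constant
      \<open>K = 2 * M\<close>.\<close>
    have geo: "(\<lambda>n. (M * norm x) * (1 / 2) ^ n) sums ((M * norm x) * 2)"
      using sums_mult[OF geometric_sums[of "1 / 2 :: real"]] by simp
    have summ: "summable (\<lambda>n. norm (v (r n)))"
      using nv by (intro summable_comparison_test'[OF sums_summable[OF geo], where N = 0]) simp
    define y where "y = (\<Sum>n. v (r n))"
    \<comment> \<open>The first components telescope: the sum of \<open>u (r k)\<close> over
      \<open>k < n\<close> is \<open>x - r n\<close>.\<close>
    have partial: "(x - r n, \<Sum>k<n. v (r k)) \<in> \<Gamma>" for n
    proof (induction n)
      case 0
      show ?case using subspace_0[OF sub] by (simp add: zero_prod_def r_0)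
    next
      case (Suc n)
      show ?case using subspace_add[OF sub Suc uv[of "r n"]] by (simp add: r_Suc algebra_simps)
    qed
    \<comment> \<open>The series in the second component converges absolutely, hence converges by
      completeness of the second space; closedness of \<open>\<Gamma>\<close> then keeps the limit
      \<open>(x, y)\<close> in \<open>\<Gamma>\<close>.\<close>
    have "(\<lambda>n. (x - r n, \<Sum>k<n. v (r k))) \<longlonglongrightarrow> (x - 0, y)"
      unfolding y_def
      by (intro tendsto_Pair tendsto_diff[OF tendsto_const r_lim]
            summable_LIMSEQ[OF summable_norm_cancel[OF summ]])
    from closed_sequentially[OF cl partial this] have "(x, y) \<in> \<Gamma>"
      by simp
    moreover have "norm y \<le> (\<Sum>n. norm (v (r n)))"
      unfolding y_def by (rule summable_norm[OF summ])
    moreover have "\<dots> \<le> 2 * M * norm x"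
      using suminf_le[OF nv summ sums_summable[OF geo]] sums_unique[OF geo] by simp
    ultimately show ?thesis by (meson order_trans)
  qed
  then show thesis using that[of "2 * M"] M by simp
qed

theorem theorem1:
  fixes sX :: "'k::real_normed_field \<Rightarrow> 'x::banach \<Rightarrow> 'x"
    and sY :: "'k \<Rightarrow> 'y::banach \<Rightarrow> 'y"
    and \<Gamma> :: "('x \<times> 'y) set"
    and B :: "'y set"
  assumes "banach_space_over sX"
    and "banach_space_over sY"
    and "linear_relation sX sY \<Gamma>"
    and "closed \<Gamma>"
    and "rel_dom \<Gamma> = UNIV"
    and "open B"
  shows "open (rel_preimage \<Gamma> B)"
proof -
  have sub: "subspace \<Gamma>"
    using linear_relation_imp_subspace assms(1-3) .
  obtain K where K: "K > 0" and sec: "\<And>x. \<exists>y. (x, y) \<in> \<Gamma> \<and> norm y \<le> K * norm x"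
    using closed_subspace_bounded_section[OF sub assms(4)] assms(5) by (metis rel_dom_eq_Domain)
  show ?thesis
    unfolding open_dist
  proof
    fix x assume "x \<in> rel_preimage \<Gamma> B"
    then obtain b where b: "b \<in> B" "(x, b) \<in> \<Gamma>" by (auto simp: rel_preimage_def)
    obtain d where d: "d > 0" "\<And>y. dist y b < d \<Longrightarrow> y \<in> B"
      using assms(6) b(1) by (metis open_dist)
    \<comment> \<open>With radius \<open>d / K\<close>, the section over \<open>x' - x\<close> has
      norm below \<open>d\<close>. Adding it to \<open>(x, b)\<close> gives a pair over
      \<open>x'\<close> whose second component stays in \<open>B\<close>.\<close>
    have "x' \<in> rel_preimage \<Gamma> B" if x': "dist x' x < d / K" for x'
    proof -
      obtain y where y: "(x' - x, y) \<in> \<Gamma>" "norm y \<le> K * norm (x' - x)" using sec by blast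
      have "(x', b + y) \<in> \<Gamma>"
        using subspace_add[OF sub b(2) y(1)] by simp
      moreover have "K * norm (x' - x) < d"
        using x' K by (simp add: dist_norm field_simps)
      with y(2) have "b + y \<in> B"
        by (intro d(2)) (simp add: dist_norm)
      ultimately show ?thesis by (auto simp: rel_preimage_def)
    qed
    then show "\<exists>e>0. \<forall>x'. dist x' x < e \<longrightarrow> x' \<in> rel_preimage \<Gamma> B"
      using d(1) K by (intro exI[of _ "d / K"]) simp
  qed
qed

end
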